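(* Let $\mathcal{H}$ and $\mathcal{K}$ be infinite dimensional Hilbert spaces, and let $A\in\mathcal{B}(\mathcal{H})$, $B\in\mathcal{B}(\mathcal{K})$ and $C\in\mathcal{B}(\mathcal{K},\mathcal{H})$ be such that $A$ and $B$ are group invertible. Define the operators on $\mathcal{H}\oplus\mathcal{K}$ $$M=\begin{bmatrix}A & C\\ 0 & B\end{bmatrix},\qquad D=\begin{bmatrix}A & 0\\ 0 & B\end{bmatrix}.$$ Then the following conditions are equivalent: (1) $M$ is group invertible. (2) $A^{\pi}CB^{\pi}=0$. (3) There exist $X,Y\in\mathcal{B}(\mathcal{K},\mathcal{H})$ such that $AX-YB=C$. (4) There exist regular operators $P,Q\in\mathcal{B}(\mathcal{H}\oplus\mathcal{K})$ such that $M$ and $D$ are pseudo-equivalent via $P$ and $Q$, i.e. $M=PDQ$ and $D=P^{-}MQ^{-}$ for some inner inverses $P^{-}$ of $P$ and $Q^{-}$ of $Q$, and such that the operator $U=DQPDD^{\sharp}+I-DD^{\sharp}$ is invertible. In this case the general solution of $AX-YB=C$ is given by $$X=A^{\sharp}C+A^{\sharp}ZB+A^{\pi}Z_{1},\qquad Y=-A^{\pi}CB^{\sharp}+Z+AA^{\sharp}ZBB^{\sharp}-ZBB^{\sharp},$$ where $Z_{1},Z\in\mathcal{B}(\mathcal{K},\mathcal{H})$ are arbitrary (that is, the pairs $(X,Y)\in\mathcal{B}(\mathcal{K},\mathcal{H})^2$ satisfying $AX-YB=C$ are exactly the pairs of this form).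
   Context: $\mathcal{B}(\mathcal{H},\mathcal{K})$ is the space of bounded linear operators from $\mathcal{H}$ to $\mathcal{K}$, $\mathcal{B}(\mathcal{H})=\mathcal{B}(\mathcal{H},\mathcal{H})$, and $I$ denotes the identity operator. An operator $S\in\mathcal{B}(\mathcal{K},\mathcal{H})$ is an inner inverse of $T\in\mathcal{B}(\mathcal{H},\mathcal{K})$ if $TST=T$; an operator is regular if it has an inner inverse. Group inverse: for a nonzero operator $A\in\mathcal{B}(\mathcal{H})$, the group inverse of $A$ is the unique (if it exists) $A^{\sharp}\in\mathcal{B}(\mathcal{H})$ with $AA^{\sharp}A=A$, $A^{\sharp}AA^{\sharp}=A^{\sharp}$, $AA^{\sharp}=A^{\sharp}A$; $A$ is group invertible if $A^{\sharp}$ exists. In that case $A^{\pi}=I-AA^{\sharp}$. When $A$ and $B$ are group invertible, so is $D$, with $D^{\sharp}=\begin{bmatrix}A^{\sharp} & 0\\ 0 & B^{\sharp}\end{bmatrix}$. *)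

theory Defs
  imports "HOL-Analysis.Analysis" "HOL-Library.Function_Algebras"
begin

text \<open>
  Hilbert spaces are treated uniformly over the real and the complex scalars: the axioms below
  hold in \<open>real\<close> with the identity and in \<open>complex\<close> with the usual conjugation. A field with a
  multiplicative norm over the reals is one of these two, and the last axiom then
  determines the conjugation.
\<close>

class hilbert_scalar = real_normed_field +
  fixes scalar_cnj :: "'a \<Rightarrow> 'a"
  assumes scalar_cnj_add: "scalar_cnj (x + y) = scalar_cnj x + scalar_cnj y"
    and scalar_cnj_mult: "scalar_cnj (x * y) = scalar_cnj x * scalar_cnj y"
    and scalar_cnj_cnj: "scalar_cnj (scalar_cnj x) = x"
    and scalar_cnj_scaleR_one: "scalar_cnj (r *\<^sub>R 1) = r *\<^sub>R 1"
    and mult_scalar_cnj: "x * scalar_cnj x = (norm x)\<^sup>2 *\<^sub>R 1"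

instantiation real :: hilbert_scalar
begin

definition scalar_cnj_real :: "real \<Rightarrow> real"
  where "scalar_cnj_real x = x"

instance
  by standard (simp_all add: scalar_cnj_real_def power2_eq_square)

end

instantiation complex :: hilbert_scalar
begin

definition scalar_cnj_complex :: "complex \<Rightarrow> complex"
  where "scalar_cnj_complex z = cnj z"

instance
  by standard (simp_all add: scalar_cnj_complex_def complex_norm_square[symmetric] scaleR_conv_of_real)

end

text \<open>
  The norm, addition, completeness and real scalar multiplication are those of the type class
  \<open>banach\<close>. Positive definiteness of the inner product is part of \<open>ip_self\<close>.
\<close>

locale hilbert_space = vector_space scale
  for scale :: "'f::hilbert_scalar \<Rightarrow> 'h::banach \<Rightarrow> 'h" +
  fixes ip :: "'h \<Rightarrow> 'h \<Rightarrow> 'f"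
  assumes scale_of_real: "scale (of_real r) x = r *\<^sub>R x"
    and ip_add_left: "ip (x + y) z = ip x z + ip y z"
    and ip_scale_left: "ip (scale c x) y = c * ip x y"
    and ip_commute: "ip x y = scalar_cnj (ip y x)"
    and ip_self: "ip x x = of_real ((norm x)\<^sup>2)"

lemma hilbert_space_real:
  "hilbert_space (scaleR :: real \<Rightarrow> 'h \<Rightarrow> 'h::{real_inner, banach}) inner"
  by unfold_locales
    (simp_all add: algebra_simps inner_commute power2_norm_eq_inner scalar_cnj_real_def)

lemma hilbert_space_complex:
  "hilbert_space ((*) :: complex \<Rightarrow> complex \<Rightarrow> complex) (\<lambda>x y. x * cnj y)"
  by unfold_locales
    (simp_all add: algebra_simps scaleR_conv_of_real scalar_cnj_complex_def
      complex_norm_square[symmetric])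

definition infinite_dimensional :: "('f::field \<Rightarrow> 'h::ab_group_add \<Rightarrow> 'h) \<Rightarrow> bool"
  where "infinite_dimensional s \<longleftrightarrow> (\<nexists>S. finite S \<and> module.span s S = UNIV)"

text \<open>
  The direct sum of two Hilbert spaces is the product type with its library norm
  (\<open>norm_prod_def\<close>) and with componentwise scalar multiplication.
\<close>

abbreviation sum_scale ::
  "('f::field \<Rightarrow> 'h::ab_group_add \<Rightarrow> 'h) \<Rightarrow> ('f \<Rightarrow> 'k::ab_group_add \<Rightarrow> 'k) \<Rightarrow> 'f \<Rightarrow> 'h \<times> 'k \<Rightarrow> 'h \<times> 'k"
  where "sum_scale \<equiv> module_prod.scale"

lemma hilbert_space_sum:
  fixes sH :: "'f::hilbert_scalar \<Rightarrow> 'h::banach \<Rightarrow> 'h" and sK :: "'f \<Rightarrow> 'k::banach \<Rightarrow> 'k"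
  assumes "hilbert_space sH ipH" and "hilbert_space sK ipK"
  shows "hilbert_space (sum_scale sH sK) (\<lambda>x y. ipH (fst x) (fst y) + ipK (snd x) (snd y))"
proof -
  interpret H: hilbert_space sH ipH by fact
  interpret K: hilbert_space sK ipK by fact
  interpret vector_space_prod sH sK ..
  show ?thesis
  proof unfold_locales
    fix x y :: "'h \<times> 'k"
    show "ipH (fst x) (fst y) + ipK (snd x) (snd y)
        = scalar_cnj (ipH (fst y) (fst x) + ipK (snd y) (snd x))"
      using H.ip_commute K.ip_commute by (metis scalar_cnj_add)
  qed (simp_all add: scale_def H.scale_of_real K.scale_of_real H.ip_add_left K.ip_add_left
      H.ip_scale_left K.ip_scale_left H.ip_self K.ip_self norm_prod_def distrib_left scaleR_prod_def)
qed

text \<open>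
  Operators are functions; sums, differences and the zero operator are the pointwise ones, the
  product is composition, and the identity operator is \<open>id\<close>. Composition is written \<open>\<odot>\<close> because
  \<open>\<circ>\<close> binds more loosely than \<open>+\<close> and \<open>-\<close>. In \<open>bounded_ops\<close>, \<open>bounded_linear\<close> gives real
  linearity and boundedness, the second conjunct linearity over the scalar field.
\<close>

abbreviation op_mult :: "('b \<Rightarrow> 'c) \<Rightarrow> ('a \<Rightarrow> 'b) \<Rightarrow> 'a \<Rightarrow> 'c"  (infixl \<open>\<odot>\<close> 70)
  where "S \<odot> T \<equiv> S \<circ> T"

definition bounded_ops ::
  "('f \<Rightarrow> 'h::real_normed_vector \<Rightarrow> 'h) \<Rightarrow> ('f \<Rightarrow> 'k::real_normed_vector \<Rightarrow> 'k) \<Rightarrow> ('h \<Rightarrow> 'k) set"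
  where "bounded_ops s t = {T. bounded_linear T \<and> (\<forall>c x. T (s c x) = t c (T x))}"

definition op_invertible :: "('f \<Rightarrow> 'h::real_normed_vector \<Rightarrow> 'h) \<Rightarrow> ('h \<Rightarrow> 'h) \<Rightarrow> bool"
  where "op_invertible s U \<longleftrightarrow>
    U \<in> bounded_ops s s \<and> (\<exists>V\<in>bounded_ops s s. U \<odot> V = id \<and> V \<odot> U = id)"

definition inner_inverse ::
  "('f \<Rightarrow> 'h::real_normed_vector \<Rightarrow> 'h) \<Rightarrow> ('f \<Rightarrow> 'k::real_normed_vector \<Rightarrow> 'k)
    \<Rightarrow> ('h \<Rightarrow> 'k) \<Rightarrow> ('k \<Rightarrow> 'h) \<Rightarrow> bool"
  where "inner_inverse s t T S \<longleftrightarrow> S \<in> bounded_ops t s \<and> T \<odot> S \<odot> T = T"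

definition regular_op ::
  "('f \<Rightarrow> 'h::real_normed_vector \<Rightarrow> 'h) \<Rightarrow> ('f \<Rightarrow> 'k::real_normed_vector \<Rightarrow> 'k)
    \<Rightarrow> ('h \<Rightarrow> 'k) \<Rightarrow> bool"
  where "regular_op s t T \<longleftrightarrow> T \<in> bounded_ops s t \<and> (\<exists>S. inner_inverse s t T S)"

text \<open>By convention only nonzero operators have a group inverse.\<close>

definition is_group_inverse ::
  "('f \<Rightarrow> 'h::real_normed_vector \<Rightarrow> 'h) \<Rightarrow> ('h \<Rightarrow> 'h) \<Rightarrow> ('h \<Rightarrow> 'h) \<Rightarrow> bool"
  where "is_group_inverse s A G \<longleftrightarrow>
    A \<in> bounded_ops s s \<and> A \<noteq> 0 \<and> G \<in> bounded_ops s s \<and>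
    A \<odot> G \<odot> A = A \<and> G \<odot> A \<odot> G = G \<and> A \<odot> G = G \<odot> A"

lemma is_group_inverse_unique:
  assumes "is_group_inverse s A G" and "is_group_inverse s A G'"
  shows "G = G'"
proof -
  have G: "A \<odot> G \<odot> A = A" "G \<odot> A \<odot> G = G" "A \<odot> G = G \<odot> A"
    and G': "A \<odot> G' \<odot> A = A" "G' \<odot> A \<odot> G' = G'" "A \<odot> G' = G' \<odot> A"
    using assms unfolding is_group_inverse_def by blast+
  have *: "A \<odot> G = A \<odot> G'"
    by (metis G(1) G(3) G'(1) G'(3) comp_assoc)
  show ?thesis
    by (metis * G(2) G(3) G'(2) G'(3) comp_assoc)
qed

definition group_invertible ::
  "('f \<Rightarrow> 'h::real_normed_vector \<Rightarrow> 'h) \<Rightarrow> ('h \<Rightarrow> 'h) \<Rightarrow> bool"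
  where "group_invertible s A \<longleftrightarrow> (\<exists>G. is_group_inverse s A G)"

definition group_inverse ::
  "('f \<Rightarrow> 'h::real_normed_vector \<Rightarrow> 'h) \<Rightarrow> ('h \<Rightarrow> 'h) \<Rightarrow> 'h \<Rightarrow> 'h"
  where "group_inverse s A = (THE G. is_group_inverse s A G)"

definition spectral_idem ::
  "('f \<Rightarrow> 'h::real_normed_vector \<Rightarrow> 'h) \<Rightarrow> ('h \<Rightarrow> 'h) \<Rightarrow> 'h \<Rightarrow> 'h"
  where "spectral_idem s A = id - A \<odot> group_inverse s A"

definition pseudo_equivalent_via ::
  "('f \<Rightarrow> 'h::real_normed_vector \<Rightarrow> 'h) \<Rightarrow> ('h \<Rightarrow> 'h) \<Rightarrow> ('h \<Rightarrow> 'h) \<Rightarrow> ('h \<Rightarrow> 'h) \<Rightarrow> ('h \<Rightarrow> 'h) \<Rightarrow> bool"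
  where "pseudo_equivalent_via s M D P Q \<longleftrightarrow>
    regular_op s s P \<and> regular_op s s Q \<and> M = P \<odot> D \<odot> Q \<and>
    (\<exists>P' Q'. inner_inverse s s P P' \<and> inner_inverse s s Q Q' \<and> D = P' \<odot> M \<odot> Q')"

text \<open>The operator with block matrix rows \<open>(A, C)\<close> and \<open>(E, B)\<close>.\<close>

definition block_op ::
  "('h \<Rightarrow> 'h::plus) \<Rightarrow> ('k \<Rightarrow> 'h) \<Rightarrow> ('h \<Rightarrow> 'k::plus) \<Rightarrow> ('k \<Rightarrow> 'k) \<Rightarrow> 'h \<times> 'k \<Rightarrow> 'h \<times> 'k"
  where "block_op A C E B = (\<lambda>(x, y). (A x + C y, E x + B y))"

end

theory Submission
  imports Defs
begin

text \<open>
  Write \<open>A\<^sup>\<sharp>\<close>, \<open>B\<^sup>\<sharp>\<close> for the group inverses and \<open>A\<^sup>\<pi> = I - AA\<^sup>\<sharp>\<close>, \<open>B\<^sup>\<pi> = I - BB\<^sup>\<sharp>\<close>. Everything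
  is decided by the single operator \<open>A\<^sup>\<pi>CB\<^sup>\<pi>\<close>.

  It is the obstruction to solving \<open>AX - YB = C\<close>: since \<open>A\<^sup>\<pi>A = 0\<close> and \<open>BB\<^sup>\<pi> = 0\<close>, every operator of
  the form \<open>AX - YB\<close> is killed by \<open>A\<^sup>\<pi> \<cdot> B\<^sup>\<pi>\<close>, while the pairs of the parametrized family satisfy
  \<open>AX - YB = C - A\<^sup>\<pi>CB\<^sup>\<pi>\<close> (\<open>sylvester_defect\<close>). The family exhausts the solutions because it returns a
  solution \<open>(X, Y)\<close> unchanged when \<open>Z = Y\<close> and \<open>Z\<^sub>1 = X\<close> (\<open>sylvester_fixed\<close>).

  It is also the obstruction to the kernel condition \<open>ker M\<^sup>2 \<subseteq> ker M\<close>: for \<open>y\<close> in \<open>\<K>\<close> the vector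
  \<open>z = (- A\<^sup>\<sharp>CB\<^sup>\<pi>y, B\<^sup>\<pi>y)\<close> satisfies \<open>M\<^sup>2z = 0\<close> and \<open>Mz = (A\<^sup>\<pi>CB\<^sup>\<pi>y, 0)\<close>
  (\<open>defect_zero_if_kernel\<close>). A group invertible \<open>M\<close> satisfies the kernel condition, since
  \<open>M = M\<^sup>\<sharp>M\<^sup>2\<close>. So does an \<open>M\<close> that is pseudo-equivalent to \<open>D\<close> with \<open>U\<close> invertible, since then \<open>P\<close>
  is injective on the range of \<open>D\<close>, and \<open>U\<close> acts there as \<open>DQP\<close> (\<open>pseudo_equivalent_kernel\<close>).

  In the other direction both properties come from explicit operators: if \<open>A\<^sup>\<pi>CB\<^sup>\<pi> = 0\<close>, then \<open>M\<close> has
  an upper triangular group inverse (\<open>upper_group_inverse\<close>), and a solution of \<open>AX - YB = C\<close> gives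
  the factorization of \<open>M\<close> through \<open>D\<close> by unipotent \<open>P\<close> and \<open>Q\<close>, for which \<open>U\<close> is upper
  triangular with the invertible diagonal entries \<open>A + A\<^sup>\<pi>\<close> and \<open>B + B\<^sup>\<pi>\<close>
  (\<open>solution_gives_pseudo_equivalence\<close>).
\<close>

section \<open>Algebra of bounded operators\<close>

lemma bounded_opsD:
  assumes "T \<in> bounded_ops s t"
  shows "bounded_linear T" and "T (s c x) = t c (T x)"
  using assms unfolding bounded_ops_def by blast+

lemma bounded_ops_linear:
  assumes "T \<in> bounded_ops s t"
  shows "T 0 = 0" and "T (x + y) = T x + T y" and "T (x - y) = T x - T y" and "T (- x) = - T x"
  using bounded_linear.linear[OF bounded_opsD(1)[OF assms]]
  by (simp_all add: linear_0 linear_add linear_diff linear_neg)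

lemma bounded_ops_comp:
  assumes "S \<in> bounded_ops t u" and "T \<in> bounded_ops s t"
  shows "S \<odot> T \<in> bounded_ops s u"
  using assms unfolding bounded_ops_def by (auto simp: o_def intro: bounded_linear_compose)

lemma bounded_ops_id: "id \<in> bounded_ops s s"
  unfolding bounded_ops_def by (simp add: id_def bounded_linear_ident)

lemma bounded_ops_zero:
  assumes "vector_space t"
  shows "0 \<in> bounded_ops s t"
proof -
  interpret vector_space t by fact
  show ?thesis unfolding bounded_ops_def by (simp add: zero_fun_def bounded_linear_zero)
qed

lemma bounded_ops_add:
  assumes "S \<in> bounded_ops s t" and "T \<in> bounded_ops s t" and "vector_space t"
  shows "S + T \<in> bounded_ops s t"
proof -
  interpret vector_space t by fact
  show ?thesis using assms(1,2) unfolding bounded_ops_def plus_fun_def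
    by (auto simp: scale_right_distrib intro: bounded_linear_add)
qed

lemma bounded_ops_uminus:
  assumes "T \<in> bounded_ops s t" and "vector_space t"
  shows "- T \<in> bounded_ops s t"
proof -
  interpret vector_space t by fact
  show ?thesis using assms(1) unfolding bounded_ops_def fun_Compl_def
    by (auto simp: scale_minus_right intro: bounded_linear_minus)
qed

lemma bounded_ops_diff:
  assumes "S \<in> bounded_ops s t" and "T \<in> bounded_ops s t" and "vector_space t"
  shows "S - T \<in> bounded_ops s t"
proof -
  interpret vector_space t by fact
  show ?thesis using assms(1,2) unfolding bounded_ops_def fun_diff_def
    by (auto simp: scale_right_diff_distrib intro: bounded_linear_sub)
qed

lemma right_invertible_regular:
  assumes "T \<in> bounded_ops s s" and "S \<in> bounded_ops s s" and "T \<odot> S = id"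
  shows "inner_inverse s s T S" and "regular_op s s T"
  using assms unfolding regular_op_def inner_inverse_def by auto

section \<open>Group inverses and the kernel condition\<close>

lemma group_inverse_eq:
  assumes "is_group_inverse s A G"
  shows "group_inverse s A = G"
  unfolding group_inverse_def
  by (rule the_equality[where P = "\<lambda>G. is_group_inverse s A G", OF assms])
    (rule is_group_inverse_unique[OF _ assms])

text \<open>
  The last three facts are a terminating and confluent rewrite system: \<open>G\<close> moves to the left of \<open>A\<close>,
  and then cancels against any surplus.
\<close>

lemma is_group_inverseD:
  assumes "is_group_inverse s A G"
  shows "A \<in> bounded_ops s s" and "G \<in> bounded_ops s s"
    and "A (G x) = G (A x)" and "G (A (A x)) = A x" and "G (G (A x)) = G x"
proof -
  have eqs: "A \<odot> G \<odot> A = A" "G \<odot> A \<odot> G = G" "A \<odot> G = G \<odot> A"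
    and "A \<in> bounded_ops s s" "G \<in> bounded_ops s s"
    using assms unfolding is_group_inverse_def by auto
  then show "A \<in> bounded_ops s s" "G \<in> bounded_ops s s" by auto
  show comm: "A (G x) = G (A x)" for x using fun_cong[OF eqs(3), of x] by simp
  show "G (A (A x)) = A x" using fun_cong[OF eqs(1), of x] by (simp add: comm)
  show "G (G (A x)) = G x" using fun_cong[OF eqs(2), of x] by (simp add: comm)
qed

lemma group_invertible_kernel:
  assumes "group_invertible s M" and "M (M z) = 0"
  shows "M z = 0"
proof -
  obtain G where G: "is_group_inverse s M G"
    using assms(1) unfolding group_invertible_def by blast
  show ?thesis
    using is_group_inverseD(4)[OF G, of z] bounded_ops_linear(1)[OF is_group_inverseD(2)[OF G]]
      assms(2) by simp
qed

text \<open>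
  The idempotent \<open>P\<^sup>-P\<close> fixes the range of \<open>D = P\<^sup>-PDQQ\<^sup>-\<close>, so \<open>P\<close> is injective on that range.
  Thus \<open>M\<^sup>2z = PDQPDQz = 0\<close> gives \<open>DQPDQz = 0\<close>, which says \<open>U(DQz) = 0\<close>.
\<close>

lemma pseudo_equivalent_kernel:
  assumes "pseudo_equivalent_via s M D P Q" and D: "is_group_inverse s D G"
    and U: "op_invertible s (D \<odot> Q \<odot> P \<odot> D \<odot> G + id - D \<odot> G)"
    and z: "M (M z) = 0"
  shows "M z = 0"
proof -
  obtain P' Q' where M: "M = P \<odot> D \<odot> Q" and P': "inner_inverse s s P P'"
    and D_eq: "D = P' \<odot> M \<odot> Q'" and P: "P \<in> bounded_ops s s"
    using assms(1) unfolding pseudo_equivalent_via_def regular_op_def by blast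
  have P'_bd: "P' \<in> bounded_ops s s" and PP'P: "P (P' (P x)) = P x" for x
    using P' unfolding inner_inverse_def by (auto simp: fun_eq_iff)
  have P'P_D: "P' (P (D x)) = D x" for x
    using PP'P D_eq unfolding M by (metis comp_apply)
  have "D (Q (P (D (Q z)))) = P' (M (M z))"
    by (simp add: M P'P_D)
  then have DQPDQ: "D (Q (P (D (Q z)))) = 0"
    using z bounded_ops_linear(1)[OF P'_bd] by simp
  let ?U = "D \<odot> Q \<odot> P \<odot> D \<odot> G + id - D \<odot> G"
  obtain V where V: "V \<in> bounded_ops s s" "V \<odot> ?U = id"
    using U unfolding op_invertible_def by blast
  have "?U (D (Q z)) = 0"
    using DQPDQ by (simp add: is_group_inverseD(3-5)[OF D])
  then have "D (Q z) = 0"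
    using fun_cong[OF V(2), of "D (Q z)"] bounded_ops_linear(1)[OF V(1)] by simp
  then show ?thesis
    using bounded_ops_linear(1)[OF P] by (simp add: M)
qed

section \<open>Upper triangular block operators\<close>

lemma block_op_bounded:
  assumes a: "a \<in> bounded_ops s s" and c: "c \<in> bounded_ops t s" and b: "b \<in> bounded_ops t t"
    and "vector_space s" and "vector_space t"
  shows "block_op a c 0 b \<in> bounded_ops (sum_scale s t) (sum_scale s t)"
proof -
  interpret S: vector_space s by fact
  interpret T: vector_space t by fact
  interpret vector_space_prod s t ..
  have eq: "block_op a c 0 b = (\<lambda>z. (a (fst z) + c (snd z), b (snd z)))"
    by (simp add: block_op_def fun_eq_iff)
  have "bounded_linear (block_op a c 0 b)"
    unfolding eq
    by (intro bounded_linear_Pair bounded_linear_add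
        bounded_linear_compose[OF bounded_opsD(1)[OF a] bounded_linear_fst]
        bounded_linear_compose[OF bounded_opsD(1)[OF c] bounded_linear_snd]
        bounded_linear_compose[OF bounded_opsD(1)[OF b] bounded_linear_snd])
  then show ?thesis
    unfolding bounded_ops_def
    by (auto simp: eq scale_def S.scale_right_distrib bounded_opsD(2)[OF a] bounded_opsD(2)[OF b]
        bounded_opsD(2)[OF c])
qed

lemma block_op_comp:
  fixes b :: "'k \<Rightarrow> 'k::ab_group_add"
  assumes "a \<in> bounded_ops s s"
  shows "block_op a c 0 b \<odot> block_op a' c' 0 b'
    = block_op (a \<odot> a') (a \<odot> c' + c \<odot> b') 0 (b \<odot> b')"
  by (simp add: block_op_def fun_eq_iff bounded_ops_linear[OF assms] algebra_simps)

lemma block_op_id: "block_op id 0 0 id = (id :: 'h::ab_group_add \<times> 'k::ab_group_add \<Rightarrow> 'h \<times> 'k)"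
  by (simp add: block_op_def fun_eq_iff)

lemma block_op_nonzero:
  fixes a :: "'h \<Rightarrow> 'h::ab_group_add" and b :: "'k \<Rightarrow> 'k::ab_group_add"
  assumes "a \<noteq> 0" and "c 0 = 0"
  shows "block_op a c 0 b \<noteq> 0"
proof
  assume zero: "block_op a c 0 b = 0"
  have "a x = 0" for x
    using fun_cong[OF zero, of "(x, 0)"] assms(2) by (simp add: block_op_def zero_prod_def)
  then show False using assms(1) by (simp add: fun_eq_iff)
qed

lemma block_op_invertible:
  assumes vs: "vector_space s" "vector_space t"
    and a: "a \<in> bounded_ops s s" "a' \<in> bounded_ops s s" "a \<odot> a' = id" "a' \<odot> a = id"
    and b: "b \<in> bounded_ops t t" "b' \<in> bounded_ops t t" "b \<odot> b' = id" "b' \<odot> b = id"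
    and c: "c \<in> bounded_ops t s"
  shows "op_invertible (sum_scale s t) (block_op a c 0 b)"
proof -
  let ?V = "block_op a' (- (a' \<odot> c \<odot> b')) 0 b'"
  have "block_op a c 0 b \<odot> ?V = block_op id 0 0 id"
    unfolding block_op_comp[OF a(1)] using a(3) b(3)
    by (simp add: fun_eq_iff bounded_ops_linear[OF a(1)] block_op_def)
  moreover have "?V \<odot> block_op a c 0 b = block_op id 0 0 id"
    unfolding block_op_comp[OF a(2)] using a(4) b(4)
    by (simp add: fun_eq_iff block_op_def)
  ultimately show ?thesis
    unfolding op_invertible_def
    by (auto simp: block_op_id intro!: bexI[of _ ?V] block_op_bounded vs a b c
        bounded_ops_uminus bounded_ops_comp)
qed

section \<open>Group invertible diagonal blocks\<close>

locale triangular_pair =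
  H: vector_space sH + K: vector_space sK
  for sH :: "'f::field \<Rightarrow> 'h::real_normed_vector \<Rightarrow> 'h"
    and sK :: "'f \<Rightarrow> 'k::real_normed_vector \<Rightarrow> 'k" +
  fixes A Ai :: "'h \<Rightarrow> 'h" and B Bi :: "'k \<Rightarrow> 'k" and C :: "'k \<Rightarrow> 'h"
  assumes A: "is_group_inverse sH A Ai" and B: "is_group_inverse sK B Bi"
    and C: "C \<in> bounded_ops sK sH"
begin

abbreviation "Api \<equiv> id - A \<odot> Ai"

abbreviation "Bpi \<equiv> id - B \<odot> Bi"

abbreviation "M \<equiv> block_op A C 0 B"

abbreviation "D \<equiv> block_op A 0 0 B"

abbreviation "Di \<equiv> block_op Ai 0 0 Bi"

text \<open>
  Backchaining with \<open>bounded_closed\<close> leaves the space between the factors of a composition open; the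
  facts about \<open>A\<close>, \<open>B\<close> and \<open>C\<close> come first in order to fix it, and in the closure lemmas the
  condition on the scalar multiplication is the last premise, where it is already determined.
\<close>

lemmas bounded = is_group_inverseD(1,2)[OF A] is_group_inverseD(1,2)[OF B] C
  H.vector_space_axioms K.vector_space_axioms

lemmas bounded_closed = bounded bounded_ops_add bounded_ops_diff bounded_ops_uminus
  bounded_ops_comp bounded_ops_id bounded_ops_zero block_op_bounded

lemmas normalize = is_group_inverseD(3-5)[OF A] is_group_inverseD(3-5)[OF B]
  bounded_ops_linear[OF is_group_inverseD(1)[OF A]] bounded_ops_linear[OF is_group_inverseD(2)[OF A]]
  bounded_ops_linear[OF is_group_inverseD(1)[OF B]] bounded_ops_linear[OF is_group_inverseD(2)[OF B]]
  bounded_ops_linear[OF C]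

subsection \<open>The equation \<open>AX - YB = C\<close>\<close>

abbreviation "solX Z Z1 \<equiv> Ai \<odot> C + Ai \<odot> Z \<odot> B + Api \<odot> Z1"

abbreviation "solY Z \<equiv> - (Api \<odot> C \<odot> Bi) + Z + A \<odot> Ai \<odot> Z \<odot> B \<odot> Bi - Z \<odot> B \<odot> Bi"

lemma sol_bounded:
  assumes "Z \<in> bounded_ops sK sH" and "Z1 \<in> bounded_ops sK sH"
  shows "solX Z Z1 \<in> bounded_ops sK sH" and "solY Z \<in> bounded_ops sK sH"
  by (rule bounded_closed assms)+

text \<open>
  The terms in \<open>Z\<close> and \<open>Z\<^sub>1\<close> cancel, and \<open>AA\<^sup>\<sharp>C + A\<^sup>\<pi>CBB\<^sup>\<sharp>\<close> is what remains.
\<close>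

lemma sylvester_defect:
  assumes Z: "Z \<in> bounded_ops sK sH"
  shows "A \<odot> solX Z Z1 - solY Z \<odot> B = C - Api \<odot> C \<odot> Bpi"
  by (simp add: fun_eq_iff normalize bounded_ops_linear[OF Z] algebra_simps)

text \<open>
  Substituting \<open>C + YB = AX\<close> collapses \<open>A\<^sup>\<sharp>(C + YB) + A\<^sup>\<pi>X\<close> to \<open>X\<close> and \<open>Y - A\<^sup>\<pi>(C + YB)B\<^sup>\<sharp>\<close> to \<open>Y\<close>.
\<close>

lemma sylvester_fixed:
  assumes X: "X \<in> bounded_ops sK sH" and Y: "Y \<in> bounded_ops sK sH"
    and eq: "A \<odot> X - Y \<odot> B = C"
  shows "solX Y X = X" and "solY Y = Y"
proof -
  have C_eq: "C y = A (X y) - Y (B y)" for y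
    using fun_cong[OF eq, of y] by simp
  show "solX Y X = X"
    by (simp add: fun_eq_iff normalize C_eq algebra_simps)
  show "solY Y = Y"
    by (simp add: fun_eq_iff normalize C_eq algebra_simps)
qed

lemma sylvester_solvable_iff:
  "(\<exists>X\<in>bounded_ops sK sH. \<exists>Y\<in>bounded_ops sK sH. A \<odot> X - Y \<odot> B = C) \<longleftrightarrow> Api \<odot> C \<odot> Bpi = 0"
proof
  assume "\<exists>X\<in>bounded_ops sK sH. \<exists>Y\<in>bounded_ops sK sH. A \<odot> X - Y \<odot> B = C"
  then obtain X Y where X: "X \<in> bounded_ops sK sH" and Y: "Y \<in> bounded_ops sK sH"
    and eq: "A \<odot> X - Y \<odot> B = C" by blast
  have "C - Api \<odot> C \<odot> Bpi = C"
    using sylvester_defect[OF Y, of X] unfolding sylvester_fixed[OF X Y eq] eq by simp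
  then show "Api \<odot> C \<odot> Bpi = 0"
    by (simp add: algebra_simps)
next
  assume zero: "Api \<odot> C \<odot> Bpi = 0"
  have Z: "0 \<in> bounded_ops sK sH" by (rule bounded_closed)+
  show "\<exists>X\<in>bounded_ops sK sH. \<exists>Y\<in>bounded_ops sK sH. A \<odot> X - Y \<odot> B = C"
    using sylvester_defect[OF Z, of 0] sol_bounded[OF Z Z] unfolding zero diff_0_right by blast
qed

lemma sylvester_general_solution:
  assumes zero: "Api \<odot> C \<odot> Bpi = 0"
  shows "{(X, Y). X \<in> bounded_ops sK sH \<and> Y \<in> bounded_ops sK sH \<and> A \<odot> X - Y \<odot> B = C}
    = {(solX Z Z1, solY Z) | Z Z1. Z \<in> bounded_ops sK sH \<and> Z1 \<in> bounded_ops sK sH}"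
    (is "?S = ?F")
proof
  show "?S \<subseteq> ?F"
  proof
    fix p
    assume "p \<in> ?S"
    then obtain X Y where p: "p = (X, Y)" and X: "X \<in> bounded_ops sK sH"
      and Y: "Y \<in> bounded_ops sK sH" and eq: "A \<odot> X - Y \<odot> B = C" by blast
    have "p = (solX Y X, solY Y)"
      unfolding p sylvester_fixed[OF X Y eq] by (rule refl)
    then show "p \<in> ?F" using X Y by blast
  qed
  show "?F \<subseteq> ?S"
    using sol_bounded sylvester_defect unfolding zero diff_0_right by blast
qed

subsection \<open>Group invertibility of the triangular operator\<close>

lemma diagonal_group_inverse: "is_group_inverse (sum_scale sH sK) D Di"
proof -
  have "A \<noteq> 0" using A unfolding is_group_inverse_def by simp
  then have "D \<noteq> 0" by (rule block_op_nonzero) simp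
  moreover have "D \<in> bounded_ops (sum_scale sH sK) (sum_scale sH sK)"
    and "Di \<in> bounded_ops (sum_scale sH sK) (sum_scale sH sK)"
    by (rule bounded_closed)+
  ultimately show ?thesis
    unfolding is_group_inverse_def
    by (simp add: block_op_def fun_eq_iff normalize)
qed

text \<open>
  The corner \<open>W\<close> is forced by \<open>MG = GM\<close> and \<open>GMG = G\<close>. The corner of \<open>MGM\<close> is then
  \<open>C - A\<^sup>\<pi>CB\<^sup>\<pi>\<close>, so the vanishing of \<open>A\<^sup>\<pi>CB\<^sup>\<pi>\<close> is what makes \<open>MGM = M\<close>.
\<close>

lemma upper_group_inverse:
  assumes zero: "Api \<odot> C \<odot> Bpi = 0"
  defines "W \<equiv> Ai \<odot> Ai \<odot> C \<odot> Bpi + Api \<odot> C \<odot> Bi \<odot> Bi - Ai \<odot> C \<odot> Bi"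
  shows "is_group_inverse (sum_scale sH sK) M (block_op Ai W 0 Bi)"
proof -
  let ?G = "block_op Ai W 0 Bi"
  have MGM: "M \<odot> ?G \<odot> M = block_op A (C - Api \<odot> C \<odot> Bpi) 0 B"
    by (simp add: W_def block_op_def fun_eq_iff normalize algebra_simps)
  have "A \<noteq> 0" using A unfolding is_group_inverse_def by simp
  then have "M \<noteq> 0" by (rule block_op_nonzero) (rule normalize)
  moreover have "M \<in> bounded_ops (sum_scale sH sK) (sum_scale sH sK)"
    and "?G \<in> bounded_ops (sum_scale sH sK) (sum_scale sH sK)"
    unfolding W_def by (rule bounded_closed)+
  moreover have "M \<odot> ?G \<odot> M = M"
    using MGM unfolding zero diff_0_right .
  moreover have "?G \<odot> M \<odot> ?G = ?G"
    by (simp add: W_def block_op_def fun_eq_iff normalize algebra_simps)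
  moreover have "M \<odot> ?G = ?G \<odot> M"
    by (simp add: W_def block_op_def fun_eq_iff normalize algebra_simps)
  ultimately show ?thesis unfolding is_group_inverse_def by blast
qed

text \<open>
  The second coordinate \<open>B\<^sup>\<pi>y\<close> lies in the kernel of \<open>B\<close>, and the first coordinate \<open>- A\<^sup>\<sharp>CB\<^sup>\<pi>y\<close> removes
  from \<open>CB\<^sup>\<pi>y\<close> the part in the range of \<open>A\<close>. The rest, \<open>A\<^sup>\<pi>CB\<^sup>\<pi>y\<close>, lies in the kernel of \<open>A\<close>.
\<close>

lemma defect_zero_if_kernel:
  assumes ker: "\<And>z. M (M z) = 0 \<Longrightarrow> M z = 0"
  shows "Api \<odot> C \<odot> Bpi = 0"
proof
  fix y
  let ?z = "(- Ai (C (Bpi y)), Bpi y)"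
  have Mz: "M ?z = ((Api \<odot> C \<odot> Bpi) y, 0)"
    by (simp add: block_op_def normalize)
  have "M (M ?z) = 0"
    unfolding Mz by (simp add: block_op_def normalize zero_prod_def)
  then have "M ?z = 0" by (rule ker)
  then show "(Api \<odot> C \<odot> Bpi) y = 0 y"
    unfolding Mz by (simp add: zero_prod_def)
qed

subsection \<open>Pseudo-equivalence from a solution\<close>

lemma solution_gives_pseudo_equivalence:
  assumes X: "X \<in> bounded_ops sK sH" and Y: "Y \<in> bounded_ops sK sH"
    and eq: "A \<odot> X - Y \<odot> B = C"
  defines "P \<equiv> block_op id (- Y) 0 id" and "Q \<equiv> block_op id X 0 id"
  shows "pseudo_equivalent_via (sum_scale sH sK) M D P Q"
    and "op_invertible (sum_scale sH sK) (D \<odot> Q \<odot> P \<odot> D \<odot> Di + id - D \<odot> Di)"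
proof -
  let ?s = "sum_scale sH sK"
  let ?P' = "block_op id Y 0 id" and ?Q' = "block_op id (- X) 0 id"
  note lin = normalize bounded_ops_linear[OF X] bounded_ops_linear[OF Y]
  have C_eq: "C y = A (X y) - Y (B y)" for y
    using fun_cong[OF eq, of y] by simp
  have bd: "P \<in> bounded_ops ?s ?s" "Q \<in> bounded_ops ?s ?s"
      "?P' \<in> bounded_ops ?s ?s" "?Q' \<in> bounded_ops ?s ?s"
    unfolding P_def Q_def by (rule bounded_closed X Y)+
  have inv: "P \<odot> ?P' = id" "Q \<odot> ?Q' = id"
    by (simp_all add: P_def Q_def block_op_def fun_eq_iff)
  have "M = P \<odot> D \<odot> Q" "D = ?P' \<odot> M \<odot> ?Q'"
    by (simp_all add: P_def Q_def block_op_def fun_eq_iff lin C_eq)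
  then show "pseudo_equivalent_via ?s M D P Q"
    unfolding pseudo_equivalent_via_def
    using right_invertible_regular[OF bd(1,3) inv(1)] right_invertible_regular[OF bd(2,4) inv(2)] by blast
  have U: "D \<odot> Q \<odot> P \<odot> D \<odot> Di + id - D \<odot> Di
      = block_op (A + Api) (A \<odot> (X - Y) \<odot> B \<odot> Bi) 0 (B + Bpi)"
    by (simp add: P_def Q_def block_op_def fun_eq_iff lin algebra_simps)
  show "op_invertible ?s (D \<odot> Q \<odot> P \<odot> D \<odot> Di + id - D \<odot> Di)"
    unfolding U
  proof (rule block_op_invertible[where a' = "Ai + Api" and b' = "Bi + Bpi"])
    show "(A + Api) \<odot> (Ai + Api) = id" "(Ai + Api) \<odot> (A + Api) = id"
      "(B + Bpi) \<odot> (Bi + Bpi) = id" "(Bi + Bpi) \<odot> (B + Bpi) = id"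
      by (simp_all add: fun_eq_iff normalize)
  qed (rule bounded_closed X Y)+
qed

end

section \<open>The equivalence and the general solution\<close>

theorem theorem4p1:
  fixes sH :: "'f::hilbert_scalar \<Rightarrow> 'h::banach \<Rightarrow> 'h" and ipH :: "'h \<Rightarrow> 'h \<Rightarrow> 'f"
    and sK :: "'f \<Rightarrow> 'k::banach \<Rightarrow> 'k" and ipK :: "'k \<Rightarrow> 'k \<Rightarrow> 'f"
    and A :: "'h \<Rightarrow> 'h" and B :: "'k \<Rightarrow> 'k" and C :: "'k \<Rightarrow> 'h"
    and M D :: "'h \<times> 'k \<Rightarrow> 'h \<times> 'k"
  assumes "hilbert_space sH ipH" and "infinite_dimensional sH"
    and "hilbert_space sK ipK" and "infinite_dimensional sK"
    and "A \<in> bounded_ops sH sH" and "B \<in> bounded_ops sK sK" and "C \<in> bounded_ops sK sH"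
    and "group_invertible sH A" and "group_invertible sK B"
    and "M = block_op A C 0 B" and "D = block_op A 0 0 B"
  shows "(group_invertible (sum_scale sH sK) M \<longleftrightarrow>
            spectral_idem sH A \<odot> C \<odot> spectral_idem sK B = 0)
    \<and> (spectral_idem sH A \<odot> C \<odot> spectral_idem sK B = 0 \<longleftrightarrow>
            (\<exists>X\<in>bounded_ops sK sH. \<exists>Y\<in>bounded_ops sK sH. A \<odot> X - Y \<odot> B = C))
    \<and> ((\<exists>X\<in>bounded_ops sK sH. \<exists>Y\<in>bounded_ops sK sH. A \<odot> X - Y \<odot> B = C) \<longleftrightarrow>
            (\<exists>P Q. pseudo_equivalent_via (sum_scale sH sK) M D P Q \<and>
               op_invertible (sum_scale sH sK)
                 (D \<odot> Q \<odot> P \<odot> D \<odot> group_inverse (sum_scale sH sK) D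
                   + id - D \<odot> group_inverse (sum_scale sH sK) D)))
    \<and> (group_invertible (sum_scale sH sK) M \<longrightarrow>
         {(X, Y). X \<in> bounded_ops sK sH \<and> Y \<in> bounded_ops sK sH \<and> A \<odot> X - Y \<odot> B = C} =
         {(group_inverse sH A \<odot> C + group_inverse sH A \<odot> Z \<odot> B + spectral_idem sH A \<odot> Z1,
           - (spectral_idem sH A \<odot> C \<odot> group_inverse sK B) + Z
             + A \<odot> group_inverse sH A \<odot> Z \<odot> B \<odot> group_inverse sK B
             - Z \<odot> B \<odot> group_inverse sK B)
          | Z Z1. Z \<in> bounded_ops sK sH \<and> Z1 \<in> bounded_ops sK sH})"
proof -
  interpret HS: hilbert_space sH ipH by fact
  interpret KS: hilbert_space sK ipK by fact
  obtain Ai where Ai: "is_group_inverse sH A Ai"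
    using assms(8) unfolding group_invertible_def by blast
  obtain Bi where Bi: "is_group_inverse sK B Bi"
    using assms(9) unfolding group_invertible_def by blast
  interpret triangular_pair sH sK A Ai B Bi C
    by unfold_locales (fact Ai Bi assms(7))+
  note names = assms(10,11) spectral_idem_def group_inverse_eq[OF Ai] group_inverse_eq[OF Bi]
    group_inverse_eq[OF diagonal_group_inverse]
  let ?s = "sum_scale sH sK"
  let ?sylvester = "\<exists>X\<in>bounded_ops sK sH. \<exists>Y\<in>bounded_ops sK sH. A \<odot> X - Y \<odot> B = C"
  let ?pseudo = "\<exists>P Q. pseudo_equivalent_via ?s (block_op A C 0 B) (block_op A 0 0 B) P Q \<and>
    op_invertible ?s (block_op A 0 0 B \<odot> Q \<odot> P \<odot> block_op A 0 0 B \<odot> block_op Ai 0 0 Bi + id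
      - block_op A 0 0 B \<odot> block_op Ai 0 0 Bi)"
  let ?defect = "(id - A \<odot> Ai) \<odot> C \<odot> (id - B \<odot> Bi) = 0"
  have group: "group_invertible ?s (block_op A C 0 B) \<longleftrightarrow> ?defect"
  proof
    assume "group_invertible ?s (block_op A C 0 B)"
    then show ?defect
      by (intro defect_zero_if_kernel) (rule group_invertible_kernel)
  next
    assume ?defect
    then show "group_invertible ?s (block_op A C 0 B)"
      unfolding group_invertible_def using upper_group_inverse by blast
  qed
  have "?sylvester \<longleftrightarrow> ?pseudo"
  proof
    assume ?sylvester
    then show ?pseudo
      using solution_gives_pseudo_equivalence by blast
  next
    assume ?pseudo
    then have ?defect
      using pseudo_equivalent_kernel[OF _ diagonal_group_inverse]
      by (intro defect_zero_if_kernel) blast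
    then show ?sylvester
      using sylvester_solvable_iff by blast
  qed
  then show ?thesis
    unfolding names using group sylvester_solvable_iff sylvester_general_solution by blast
qed

end
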